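(* Let $\mathfrak{q}$ be a $\mathsf{Lie}$-nilpotent Leibniz algebra of class 2. Then $$Z\left(\mathsf{Der}_z^{\mathsf{Lie}}(\mathfrak{q})\right)\cong T\left(\frac{\mathfrak{q}}{Z_{\mathsf{Lie}}(\mathfrak{q})},[\mathfrak{q},\mathfrak{q}]_{\mathsf{Lie}}\right),$$ where $Z(\mathsf{Der}_z^{\mathsf{Lie}}(\mathfrak{q}))$ is the center of the Lie algebra $\mathsf{Der}_z^{\mathsf{Lie}}(\mathfrak{q})$.
   Context: $\mathbb{K}$ is a fixed ground field with $\frac12\in\mathbb{K}$. A Leibniz algebra over $\mathbb{K}$ is a $\mathbb{K}$-vector space $\mathfrak{g}$ with a bilinear bracket satisfying $[x,[y,z]]=[[x,y],z]-[[x,z],y]$ for all $x,y,z$. Put $[x,y]_{lie}=[x,y]+[y,x]$. The $\mathsf{Lie}$-center is $Z_{\mathsf{Lie}}(\mathfrak{g})=\{z\in\mathfrak{g}\mid [g,z]_{lie}=0\ \text{for all } g\in\mathfrak{g}\}$. For two-sided ideals $\mathfrak{m},\mathfrak{n}$ of $\mathfrak{g}$, $[\mathfrak{m},\mathfrak{n}]_{\mathsf{Lie}}$ is the two-sided ideal generated by all $[m,n]_{lie}$, $m\in\mathfrak{m}$, $n\in\mathfrak{n}$. Put $\gamma_1^{\mathsf{Lie}}(\mathfrak{g})=\mathfrak{g}$, $\gamma_i^{\mathsf{Lie}}(\mathfrak{g})=[\gamma_{i-1}^{\mathsf{Lie}}(\mathfrak{g}),\mathfrak{g}]_{\mathsf{Lie}}$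 for $i\ge2$. $\mathfrak{g}$ is $\mathsf{Lie}$-nilpotent of class $c$ if $\gamma_{c+1}^{\mathsf{Lie}}(\mathfrak{g})=0$ and $\gamma_c^{\mathsf{Lie}}(\mathfrak{g})\ne0$. A $\mathsf{Lie}$-derivation of $\mathfrak{g}$ is a linear map $d:\mathfrak{g}\to\mathfrak{g}$ with $d([x,y]_{lie})=[d(x),y]_{lie}+[x,d(y)]_{lie}$ for all $x,y$; $\mathsf{Der}^{\mathsf{Lie}}(\mathfrak{g})$ is the Lie algebra of these under the commutator, and $\mathsf{Der}_z^{\mathsf{Lie}}(\mathfrak{g})$ is the Lie subalgebra of those $d$ with $d(\mathfrak{g})\subseteq Z_{\mathsf{Lie}}(\mathfrak{g})$. For Leibniz algebras $A,B$, $T(A,B)$ is the vector space of all linear maps $A\to B$; when $B$ has zero bracket (as is the case for $[\mathfrak{q},\mathfrak{q}]_{\mathsf{Lie}}$), $T(A,B)$ carries the pointwise, hence zero, bracket and is regarded as an abelian Lie algebra. *)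

theory Defs
  imports "HOL-Algebra.QuotRing" "HOL-Algebra.Module"
begin

text \<open>
  A (nonassociative) algebra over a field \<open>K\<close> is represented by a record of type \<open>module\<close>
  whose field \<open>mult\<close> is the bracket, so \<open>x \<otimes>\<^bsub>g\<^esub> y\<close> stands for \<open>[x, y]\<close>.
  The field \<open>one\<close> of that record has no meaning here and no definition below depends on it.
\<close>

locale leibniz_algebra = K?: field K + g?: module K g for K (structure) and g (structure) +
  assumes bracket_closed:
      "\<lbrakk>x \<in> carrier g; y \<in> carrier g\<rbrakk> \<Longrightarrow> x \<otimes>\<^bsub>g\<^esub> y \<in> carrier g"
    and bracket_add_left:
      "\<lbrakk>x \<in> carrier g; y \<in> carrier g; z \<in> carrier g\<rbrakk> \<Longrightarrow>
       (x \<oplus>\<^bsub>g\<^esub> y) \<otimes>\<^bsub>g\<^esub> z = (x \<otimes>\<^bsub>g\<^esub> z) \<oplus>\<^bsub>g\<^esub> (y \<otimes>\<^bsub>g\<^esub> z)"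
    and bracket_add_right:
      "\<lbrakk>x \<in> carrier g; y \<in> carrier g; z \<in> carrier g\<rbrakk> \<Longrightarrow>
       x \<otimes>\<^bsub>g\<^esub> (y \<oplus>\<^bsub>g\<^esub> z) = (x \<otimes>\<^bsub>g\<^esub> y) \<oplus>\<^bsub>g\<^esub> (x \<otimes>\<^bsub>g\<^esub> z)"
    and bracket_smult_left:
      "\<lbrakk>k \<in> carrier K; x \<in> carrier g; y \<in> carrier g\<rbrakk> \<Longrightarrow>
       (k \<odot>\<^bsub>g\<^esub> x) \<otimes>\<^bsub>g\<^esub> y = k \<odot>\<^bsub>g\<^esub> (x \<otimes>\<^bsub>g\<^esub> y)"
    and bracket_smult_right:
      "\<lbrakk>k \<in> carrier K; x \<in> carrier g; y \<in> carrier g\<rbrakk> \<Longrightarrow>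
       x \<otimes>\<^bsub>g\<^esub> (k \<odot>\<^bsub>g\<^esub> y) = k \<odot>\<^bsub>g\<^esub> (x \<otimes>\<^bsub>g\<^esub> y)"
    and leibniz_identity:
      "\<lbrakk>x \<in> carrier g; y \<in> carrier g; z \<in> carrier g\<rbrakk> \<Longrightarrow>
       x \<otimes>\<^bsub>g\<^esub> (y \<otimes>\<^bsub>g\<^esub> z) = ((x \<otimes>\<^bsub>g\<^esub> y) \<otimes>\<^bsub>g\<^esub> z) \<ominus>\<^bsub>g\<^esub> ((x \<otimes>\<^bsub>g\<^esub> z) \<otimes>\<^bsub>g\<^esub> y)"

definition lie_bracket :: "('k, 'a) module \<Rightarrow> 'a \<Rightarrow> 'a \<Rightarrow> 'a" where
  "lie_bracket g x y = (x \<otimes>\<^bsub>g\<^esub> y) \<oplus>\<^bsub>g\<^esub> (y \<otimes>\<^bsub>g\<^esub> x)"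

definition lie_center :: "('k, 'a) module \<Rightarrow> 'a set" where
  "lie_center g = {z \<in> carrier g. \<forall>x \<in> carrier g. lie_bracket g x z = \<zero>\<^bsub>g\<^esub>}"

definition two_sided_ideal :: "'k ring \<Rightarrow> ('k, 'a) module \<Rightarrow> 'a set \<Rightarrow> bool" where
  "two_sided_ideal K g I \<longleftrightarrow> submodule I K g \<and>
     (\<forall>a \<in> I. \<forall>x \<in> carrier g. a \<otimes>\<^bsub>g\<^esub> x \<in> I \<and> x \<otimes>\<^bsub>g\<^esub> a \<in> I)"

definition ideal_generated_by :: "'k ring \<Rightarrow> ('k, 'a) module \<Rightarrow> 'a set \<Rightarrow> 'a set" where
  "ideal_generated_by K g S = \<Inter>{I. two_sided_ideal K g I \<and> S \<subseteq> I}"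

definition lie_commutator :: "'k ring \<Rightarrow> ('k, 'a) module \<Rightarrow> 'a set \<Rightarrow> 'a set \<Rightarrow> 'a set" where
  "lie_commutator K g M N = ideal_generated_by K g {lie_bracket g m n | m n. m \<in> M \<and> n \<in> N}"

text \<open>The series starts at index 1; the value at index 0 is a dummy.\<close>

fun lie_lower_central :: "'k ring \<Rightarrow> ('k, 'a) module \<Rightarrow> nat \<Rightarrow> 'a set" where
  "lie_lower_central K g 0 = carrier g"
| "lie_lower_central K g (Suc 0) = carrier g"
| "lie_lower_central K g (Suc (Suc i)) =
     lie_commutator K g (lie_lower_central K g (Suc i)) (carrier g)"

definition lie_nilpotent_of_class :: "'k ring \<Rightarrow> ('k, 'a) module \<Rightarrow> nat \<Rightarrow> bool" where
  "lie_nilpotent_of_class K g c \<longleftrightarrow> 1 \<le> c \<and>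
     lie_lower_central K g (c + 1) = {\<zero>\<^bsub>g\<^esub>} \<and> lie_lower_central K g c \<noteq> {\<zero>\<^bsub>g\<^esub>}"

text \<open>
  Linear maps are taken to be \<open>undefined\<close> outside the carrier of their domain, so that two
  of them are equal exactly when they agree on that carrier.
\<close>

definition linear_maps :: "'k ring \<Rightarrow> ('k, 'a) module \<Rightarrow> ('k, 'b) module \<Rightarrow> ('a \<Rightarrow> 'b) set" where
  "linear_maps K A B = {f \<in> carrier A \<rightarrow>\<^sub>E carrier B.
     (\<forall>x \<in> carrier A. \<forall>y \<in> carrier A. f (x \<oplus>\<^bsub>A\<^esub> y) = f x \<oplus>\<^bsub>B\<^esub> f y) \<and>
     (\<forall>k \<in> carrier K. \<forall>x \<in> carrier A. f (k \<odot>\<^bsub>A\<^esub> x) = k \<odot>\<^bsub>B\<^esub> f x)}"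

text \<open>\<open>T(A, B)\<close>: all linear maps, with pointwise operations including the bracket.\<close>

definition linear_map_algebra ::
    "'k ring \<Rightarrow> ('k, 'a) module \<Rightarrow> ('k, 'b) module \<Rightarrow> ('k, 'a \<Rightarrow> 'b) module" where
  "linear_map_algebra K A B =
     \<lparr>carrier = linear_maps K A B,
      mult = (\<lambda>f h. \<lambda>x \<in> carrier A. f x \<otimes>\<^bsub>B\<^esub> h x),
      one = undefined,
      zero = (\<lambda>x \<in> carrier A. \<zero>\<^bsub>B\<^esub>),
      add = (\<lambda>f h. \<lambda>x \<in> carrier A. f x \<oplus>\<^bsub>B\<^esub> h x),
      smult = (\<lambda>k f. \<lambda>x \<in> carrier A. k \<odot>\<^bsub>B\<^esub> f x)\<rparr>"

definition lie_derivations :: "'k ring \<Rightarrow> ('k, 'a) module \<Rightarrow> ('a \<Rightarrow> 'a) set" where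
  "lie_derivations K g = {d \<in> linear_maps K g g. \<forall>x \<in> carrier g. \<forall>y \<in> carrier g.
     d (lie_bracket g x y) = lie_bracket g (d x) y \<oplus>\<^bsub>g\<^esub> lie_bracket g x (d y)}"

definition lie_der_algebra :: "'k ring \<Rightarrow> ('k, 'a) module \<Rightarrow> ('k, 'a \<Rightarrow> 'a) module" where
  "lie_der_algebra K g = (linear_map_algebra K g g)
     \<lparr>carrier := lie_derivations K g,
      mult := (\<lambda>d e. \<lambda>x \<in> carrier g. d (e x) \<ominus>\<^bsub>g\<^esub> e (d x))\<rparr>"

definition central_lie_der_algebra :: "'k ring \<Rightarrow> ('k, 'a) module \<Rightarrow> ('k, 'a \<Rightarrow> 'a) module" where
  "central_lie_der_algebra K g = (lie_der_algebra K g)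
     \<lparr>carrier := {d \<in> lie_derivations K g. d ` carrier g \<subseteq> lie_center g}\<rparr>"

text \<open>The center of a Lie algebra \<open>L\<close>, as a Lie algebra with the operations of \<open>L\<close>.\<close>

definition center_algebra :: "('k, 'a) module \<Rightarrow> ('k, 'a) module" where
  "center_algebra L = L\<lparr>carrier := {z \<in> carrier L. \<forall>x \<in> carrier L. z \<otimes>\<^bsub>L\<^esub> x = \<zero>\<^bsub>L\<^esub>}\<rparr>"

definition quotient_algebra :: "('k, 'a) module \<Rightarrow> 'a set \<Rightarrow> ('k, 'a set) module" where
  "quotient_algebra g I =
     \<lparr>carrier = a_rcosets\<^bsub>g\<^esub> I, mult = rcoset_mult g I, one = undefined,
      zero = I, add = set_add g, smult = (\<lambda>k X. \<Union>x \<in> X. I +>\<^bsub>g\<^esub> (k \<odot>\<^bsub>g\<^esub> x))\<rparr>"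

definition algebra_isomorphic ::
    "'k ring \<Rightarrow> ('k, 'a) module \<Rightarrow> ('k, 'b) module \<Rightarrow> bool" where
  "algebra_isomorphic K L M \<longleftrightarrow> (\<exists>f \<in> linear_maps K L M. bij_betw f (carrier L) (carrier M) \<and>
     (\<forall>x \<in> carrier L. \<forall>y \<in> carrier L. f (x \<otimes>\<^bsub>L\<^esub> y) = f x \<otimes>\<^bsub>M\<^esub> f y))"

end

theory Submission
  imports Defs
begin

text \<open>
  Write \<open>Z\<close> for the Lie-center and \<open>L\<close> for \<open>[q, q]\<^sub>L\<^sub>i\<^sub>e\<close>; class 2 gives
  \<open>L \<subseteq> Z \<noteq> q\<close> and \<open>L \<noteq> 0\<close>. The central Lie-derivations are exactly the
  linear maps \<open>q \<rightarrow> Z\<close> that vanish on \<open>L\<close>; among them are the rank one maps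
  \<open>x \<mapsto> \<phi>(x) w\<close> with \<open>w \<in> Z\<close> and \<open>\<phi>\<close> a functional vanishing on \<open>L\<close>. If \<open>d\<close> commutes
  with such a map then \<open>\<phi>(x) d(w) = \<phi>(d(x)) w\<close>. Taking \<open>\<phi>\<close> to vanish on \<open>Z\<close> but not at
  \<open>x\<close> yields \<open>d(w) = 0\<close> for all \<open>w \<in> Z\<close>; taking then any \<open>w \<noteq> 0\<close> shows that every \<open>\<phi>\<close>
  vanishing on \<open>L\<close> vanishes at \<open>d(x)\<close>, so \<open>d(x) \<in> L\<close>. Hence the center consists of the linear
  maps \<open>q \<rightarrow> L\<close> that vanish on \<open>Z\<close>, which are the linear maps \<open>q/Z \<rightarrow> L\<close>.
\<close>

section \<open>Linear functionals separating a vector from a subspace\<close>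

text \<open>Zorn's lemma applies because the union of a nonempty chain of submodules that contain
  \<open>S\<close> and miss \<open>v\<close> is again one. Over a field, \<open>H\<close> becomes
  the kernel of a functional.\<close>

lemma (in module) ex_maximal_submodule_avoiding:
  assumes "submodule S R M" "v \<notin> S"
  obtains H where "submodule H R M" "S \<subseteq> H" "v \<notin> H"
    "\<And>H'. submodule H' R M \<Longrightarrow> H \<subseteq> H' \<Longrightarrow> v \<notin> H' \<Longrightarrow> H' = H"
proof -
  let ?A = "{H. submodule H R M \<and> S \<subseteq> H \<and> v \<notin> H}"
  have "\<exists>H\<in>?A. \<forall>X\<in>?A. H \<subseteq> X \<longrightarrow> X = H"
  proof (rule subset_Zorn_nonempty)
    show "?A \<noteq> {}" using assms by blast
  next
    fix C assume "C \<noteq> {}" and C: "subset.chain ?A C"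
    then obtain H0 where H0: "H0 \<in> C" by blast
    have sub: "submodule H R M" "S \<subseteq> H" "v \<notin> H" if "H \<in> C" for H
      using C that unfolding subset.chain_def by auto
    have lin: "H \<subseteq> H' \<or> H' \<subseteq> H" if "H \<in> C" "H' \<in> C" for H H'
      using C that unfolding subset.chain_def by blast
    have "submodule (\<Union>C) R M"
    proof (rule submoduleI)
      show "\<Union>C \<subseteq> carrier M" using sub(1) submoduleE(1) by blast
      show "\<zero>\<^bsub>M\<^esub> \<in> \<Union>C"
        using subgroup.one_closed[OF submodule.axioms(1)[OF sub(1)[OF H0]]] H0 by auto
      show "\<ominus>\<^bsub>M\<^esub> a \<in> \<Union>C" if "a \<in> \<Union>C" for a
        using that sub(1) submoduleE(3) by blast
      show "a \<odot>\<^bsub>M\<^esub> x \<in> \<Union>C" if "a \<in> carrier R" "x \<in> \<Union>C" for a x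
        using that sub(1) submoduleE(4) by blast
      show "a \<oplus>\<^bsub>M\<^esub> b \<in> \<Union>C" if ab: "a \<in> \<Union>C" "b \<in> \<Union>C" for a b
      proof -
        \<comment> \<open>Of two members of a chain, the larger one contains both summands.\<close>
        obtain A B where "A \<in> C" "a \<in> A" "B \<in> C" "b \<in> B" using ab by blast
        then obtain D where "D \<in> C" "a \<in> D" "b \<in> D" using lin by blast
        then show ?thesis using submoduleE(5)[OF sub(1)] by blast
      qed
    qed
    then show "\<Union>C \<in> ?A" using sub H0 by blast
  qed
  then obtain H where H: "H \<in> ?A" "\<forall>X\<in>?A. H \<subseteq> X \<longrightarrow> X = H" ..
  show thesis
  proof (rule that[of H])
    show "H' = H" if "submodule H' R M" "H \<subseteq> H'" "v \<notin> H'" for H'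
      by (rule H(2)[rule_format]) (use H(1) that in auto)
  qed (use H(1) in auto)
qed

text \<open>A submodule \<open>H\<close> maximal among those containing \<open>S\<close> and missing
  \<open>v\<close> is a hyperplane complementary to the line through \<open>v\<close>. The
  functional reads off the coefficient of \<open>v\<close> modulo \<open>H\<close>, so no basis has
  to be chosen.\<close>

lemma (in module) separating_functional:
  assumes "field R" "submodule S R M" "v \<in> carrier M" "v \<notin> S"
  obtains \<phi> where "\<phi> \<in> carrier M \<rightarrow> carrier R"
    "\<And>x y. x \<in> carrier M \<Longrightarrow> y \<in> carrier M \<Longrightarrow> \<phi> (x \<oplus>\<^bsub>M\<^esub> y) = \<phi> x \<oplus> \<phi> y"
    "\<And>k x. k \<in> carrier R \<Longrightarrow> x \<in> carrier M \<Longrightarrow> \<phi> (k \<odot>\<^bsub>M\<^esub> x) = k \<otimes> \<phi> x"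
    "\<And>x. x \<in> S \<Longrightarrow> \<phi> x = \<zero>" "\<phi> v = \<one>"
proof -
  interpret F: field R by fact
  note v[simp] = \<open>v \<in> carrier M\<close>
  obtain H where H: "submodule H R M" "S \<subseteq> H" "v \<notin> H"
    and max: "\<And>H'. submodule H' R M \<Longrightarrow> H \<subseteq> H' \<Longrightarrow> v \<notin> H' \<Longrightarrow> H' = H"
    using ex_maximal_submodule_avoiding[OF assms(2,4)] by metis
  note HE = submoduleE[OF H(1)]
  have Hc[simp]: "x \<in> carrier M" if "x \<in> H" for x using HE(1) that by blast
  have H0[simp]: "\<zero>\<^bsub>M\<^esub> \<in> H"
    using subgroup.one_closed[OF submodule.axioms(1)[OF H(1)]] by simp
  have minus_zero_M: "\<ominus>\<^bsub>M\<^esub> \<zero>\<^bsub>M\<^esub> = \<zero>\<^bsub>M\<^esub>"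
    by (rule M.minus_equality) simp_all
  \<comment> \<open>Nonzero scalars are units, so they can be cancelled from membership in
    \<open>H\<close>.\<close>
  have scale: "y \<in> H" if "k \<in> carrier R" "k \<noteq> \<zero>" "y \<in> carrier M" "k \<odot>\<^bsub>M\<^esub> y \<in> H" for k y
  proof -
    have k: "k \<in> Units R" using that F.field_Units by simp
    have "inv k \<odot>\<^bsub>M\<^esub> (k \<odot>\<^bsub>M\<^esub> y) = y"
      using k that by (simp add: smult_assoc1[symmetric])
    then show ?thesis using HE(4)[of "inv k" "k \<odot>\<^bsub>M\<^esub> y"] k that by simp
  qed
  \<comment> \<open>By maximality, \<open>M\<close> is the direct sum of \<open>H\<close> and the line through \<open>v\<close>.\<close>
  have ex: "\<exists>k. k \<in> carrier R \<and> x \<ominus>\<^bsub>M\<^esub> k \<odot>\<^bsub>M\<^esub> v \<in> H" if x[simp]: "x \<in> carrier M" for x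
  proof (cases "x \<in> H")
    case True
    then have "x \<ominus>\<^bsub>M\<^esub> \<zero> \<odot>\<^bsub>M\<^esub> v \<in> H" by (simp add: M.minus_eq minus_zero_M)
    then show ?thesis by blast
  next
    case False
    \<comment> \<open>The span of \<open>H\<close> and \<open>x\<close> is strictly larger than
      \<open>H\<close>, so by maximality it contains \<open>v\<close>. Its coefficient
      \<open>c\<close> at \<open>x\<close> is nonzero because \<open>v\<close> is not in
      \<open>H\<close>; solving for \<open>x\<close> gives the coefficient
      \<open>inv c\<close>.\<close>
    let ?H = "{h \<oplus>\<^bsub>M\<^esub> c \<odot>\<^bsub>M\<^esub> x | h c. h \<in> H \<and> c \<in> carrier R}"
    have "submodule ?H R M"
    proof (rule submoduleI)
      show "?H \<subseteq> carrier M" by auto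
      have "\<zero>\<^bsub>M\<^esub> \<oplus>\<^bsub>M\<^esub> \<zero> \<odot>\<^bsub>M\<^esub> x \<in> ?H" using H0 R.zero_closed by blast
      then show "\<zero>\<^bsub>M\<^esub> \<in> ?H" by simp
    next
      fix a assume "a \<in> ?H"
      then obtain h c where "a = h \<oplus>\<^bsub>M\<^esub> c \<odot>\<^bsub>M\<^esub> x" "h \<in> H" "c \<in> carrier R" by blast
      moreover from this have "\<ominus>\<^bsub>M\<^esub> a = (\<ominus>\<^bsub>M\<^esub> h) \<oplus>\<^bsub>M\<^esub> (\<ominus> c) \<odot>\<^bsub>M\<^esub> x"
        by (simp add: smult_l_minus M.minus_add)
      ultimately show "\<ominus>\<^bsub>M\<^esub> a \<in> ?H" using HE(3) R.a_inv_closed by blast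
    next
      fix a b assume "a \<in> ?H" "b \<in> ?H"
      then obtain h c h' c' where "a = h \<oplus>\<^bsub>M\<^esub> c \<odot>\<^bsub>M\<^esub> x" "h \<in> H" "c \<in> carrier R"
        "b = h' \<oplus>\<^bsub>M\<^esub> c' \<odot>\<^bsub>M\<^esub> x" "h' \<in> H" "c' \<in> carrier R" by blast
      moreover from this have "a \<oplus>\<^bsub>M\<^esub> b = (h \<oplus>\<^bsub>M\<^esub> h') \<oplus>\<^bsub>M\<^esub> (c \<oplus> c') \<odot>\<^bsub>M\<^esub> x"
        by (simp add: smult_l_distr M.add.m_ac)
      ultimately show "a \<oplus>\<^bsub>M\<^esub> b \<in> ?H" using HE(5) R.a_closed by blast
    next
      fix k a assume "k \<in> carrier R" "a \<in> ?H"
      then obtain h c where "a = h \<oplus>\<^bsub>M\<^esub> c \<odot>\<^bsub>M\<^esub> x" "h \<in> H" "c \<in> carrier R" by blast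
      moreover from this \<open>k \<in> carrier R\<close> have "k \<odot>\<^bsub>M\<^esub> a = (k \<odot>\<^bsub>M\<^esub> h) \<oplus>\<^bsub>M\<^esub> (k \<otimes> c) \<odot>\<^bsub>M\<^esub> x"
        by (simp add: smult_r_distr smult_assoc1)
      ultimately show "k \<odot>\<^bsub>M\<^esub> a \<in> ?H" using \<open>k \<in> carrier R\<close> HE(4) R.m_closed by blast
    qed
    moreover have "H \<subseteq> ?H"
    proof
      fix h assume "h \<in> H"
      then have "h \<oplus>\<^bsub>M\<^esub> \<zero> \<odot>\<^bsub>M\<^esub> x \<in> ?H" using R.zero_closed by blast
      then show "h \<in> ?H" using \<open>h \<in> H\<close> by simp
    qed
    moreover have "?H \<noteq> H"
    proof -
      have "\<zero>\<^bsub>M\<^esub> \<oplus>\<^bsub>M\<^esub> \<one> \<odot>\<^bsub>M\<^esub> x \<in> ?H" using H0 R.one_closed by blast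
      then have "x \<in> ?H" by simp
      then show ?thesis using False by blast
    qed
    ultimately have "v \<in> ?H" using max by blast
    then obtain h c where hc: "v = h \<oplus>\<^bsub>M\<^esub> c \<odot>\<^bsub>M\<^esub> x" "h \<in> H" "c \<in> carrier R" by blast
    have "c \<noteq> \<zero>" using hc H(3) by auto
    then have c: "c \<in> Units R" using hc(3) F.field_Units by simp
    have "c \<odot>\<^bsub>M\<^esub> (x \<ominus>\<^bsub>M\<^esub> inv c \<odot>\<^bsub>M\<^esub> v) = c \<odot>\<^bsub>M\<^esub> x \<oplus>\<^bsub>M\<^esub> \<ominus>\<^bsub>M\<^esub> v"
      using c hc(3)
      by (simp add: M.minus_eq smult_r_distr smult_r_minus smult_assoc1[symmetric])
    also have "\<dots> = \<ominus>\<^bsub>M\<^esub> h"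
      using hc(2,3) unfolding hc(1) by (simp add: M.minus_add M.add.m_ac M.r_neg2 M.r_neg)
    finally have "c \<odot>\<^bsub>M\<^esub> (x \<ominus>\<^bsub>M\<^esub> inv c \<odot>\<^bsub>M\<^esub> v) \<in> H" using HE(3) hc(2) by simp
    then have "x \<ominus>\<^bsub>M\<^esub> inv c \<odot>\<^bsub>M\<^esub> v \<in> H" using scale[OF hc(3) \<open>c \<noteq> \<zero>\<close>] c by simp
    then show ?thesis using c by blast
  qed
  have uniq: "k = l"
    if "k \<in> carrier R" "l \<in> carrier R" "x \<in> carrier M"
      "x \<ominus>\<^bsub>M\<^esub> k \<odot>\<^bsub>M\<^esub> v \<in> H" "x \<ominus>\<^bsub>M\<^esub> l \<odot>\<^bsub>M\<^esub> v \<in> H" for k l x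
  proof (rule ccontr)
    assume "k \<noteq> l"
    \<comment> \<open>Two different coefficients would put a nonzero multiple of \<open>v\<close>,
      and hence \<open>v\<close> itself, into \<open>H\<close>.\<close>
    have "(l \<ominus> k) \<odot>\<^bsub>M\<^esub> v = (x \<ominus>\<^bsub>M\<^esub> k \<odot>\<^bsub>M\<^esub> v) \<oplus>\<^bsub>M\<^esub> \<ominus>\<^bsub>M\<^esub> (x \<ominus>\<^bsub>M\<^esub> l \<odot>\<^bsub>M\<^esub> v)"
      using that(1-3)
      by (simp add: R.minus_eq M.minus_eq smult_l_distr smult_l_minus M.minus_add M.add.m_ac M.r_neg2 M.r_neg)
    then have "(l \<ominus> k) \<odot>\<^bsub>M\<^esub> v \<in> H" using HE(3,5) that by metis
    moreover have "l = (l \<ominus> k) \<oplus> k"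
      using that by (simp add: R.minus_eq R.a_assoc R.l_neg)
    then have "l \<ominus> k \<noteq> \<zero>" using \<open>k \<noteq> l\<close> that(1) by auto
    ultimately show False using scale[of "l \<ominus> k" v] H(3) that by simp
  qed
  define \<phi> where "\<phi> x = (THE k. k \<in> carrier R \<and> x \<ominus>\<^bsub>M\<^esub> k \<odot>\<^bsub>M\<^esub> v \<in> H)" for x
  have \<phi>I: "\<phi> x = k" if "k \<in> carrier R" "x \<in> carrier M" "x \<ominus>\<^bsub>M\<^esub> k \<odot>\<^bsub>M\<^esub> v \<in> H" for k x
    unfolding \<phi>_def
  proof (rule the_equality)
    show "k \<in> carrier R \<and> x \<ominus>\<^bsub>M\<^esub> k \<odot>\<^bsub>M\<^esub> v \<in> H" using that by simp
    show "l = k" if "l \<in> carrier R \<and> x \<ominus>\<^bsub>M\<^esub> l \<odot>\<^bsub>M\<^esub> v \<in> H" for l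
      by (rule uniq[of l k x]) (use that \<open>k \<in> carrier R\<close> \<open>x \<in> carrier M\<close> \<open>x \<ominus>\<^bsub>M\<^esub> k \<odot>\<^bsub>M\<^esub> v \<in> H\<close> in simp_all)
  qed
  have \<phi>: "\<phi> x \<in> carrier R" "x \<ominus>\<^bsub>M\<^esub> \<phi> x \<odot>\<^bsub>M\<^esub> v \<in> H" if "x \<in> carrier M" for x
  proof -
    obtain k where "k \<in> carrier R" "x \<ominus>\<^bsub>M\<^esub> k \<odot>\<^bsub>M\<^esub> v \<in> H" using ex[OF \<open>x \<in> carrier M\<close>] by blast
    moreover from this have "\<phi> x = k" using \<phi>I that by blast
    ultimately show "\<phi> x \<in> carrier R" "x \<ominus>\<^bsub>M\<^esub> \<phi> x \<odot>\<^bsub>M\<^esub> v \<in> H" by simp_all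
  qed
  show thesis
  proof
    show "\<phi> \<in> carrier M \<rightarrow> carrier R" using \<phi> by blast
  next
    fix x y assume xy: "x \<in> carrier M" "y \<in> carrier M"
    have "(x \<oplus>\<^bsub>M\<^esub> y) \<ominus>\<^bsub>M\<^esub> (\<phi> x \<oplus> \<phi> y) \<odot>\<^bsub>M\<^esub> v
        = (x \<ominus>\<^bsub>M\<^esub> \<phi> x \<odot>\<^bsub>M\<^esub> v) \<oplus>\<^bsub>M\<^esub> (y \<ominus>\<^bsub>M\<^esub> \<phi> y \<odot>\<^bsub>M\<^esub> v)"
      using xy \<phi>(1) by (simp add: M.minus_eq smult_l_distr M.minus_add M.add.m_ac)
    then show "\<phi> (x \<oplus>\<^bsub>M\<^esub> y) = \<phi> x \<oplus> \<phi> y"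
      using \<phi>I[of "\<phi> x \<oplus> \<phi> y" "x \<oplus>\<^bsub>M\<^esub> y"] HE(5) \<phi> xy by simp
  next
    fix k x assume kx: "k \<in> carrier R" "x \<in> carrier M"
    have "k \<odot>\<^bsub>M\<^esub> x \<ominus>\<^bsub>M\<^esub> (k \<otimes> \<phi> x) \<odot>\<^bsub>M\<^esub> v = k \<odot>\<^bsub>M\<^esub> (x \<ominus>\<^bsub>M\<^esub> \<phi> x \<odot>\<^bsub>M\<^esub> v)"
      using kx \<phi>(1) by (simp add: M.minus_eq smult_r_distr smult_r_minus smult_assoc1)
    then show "\<phi> (k \<odot>\<^bsub>M\<^esub> x) = k \<otimes> \<phi> x"
      using \<phi>I[of "k \<otimes> \<phi> x" "k \<odot>\<^bsub>M\<^esub> x"] HE(4) \<phi> kx by simp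
  next
    fix x assume "x \<in> S"
    then have "x \<in> H" using H(2) by blast
    then show "\<phi> x = \<zero>" by (intro \<phi>I) (simp_all add: M.minus_eq minus_zero_M)
  next
    show "\<phi> v = \<one>" by (intro \<phi>I) (simp_all add: M.minus_eq M.r_neg)
  qed
qed


section \<open>Symmetrized bracket, Lie-center and generated ideals\<close>

text \<open>The operations defined on Leibniz algebras expect records without extension fields.\<close>

locale plain_leibniz_algebra = leibniz_algebra K g
  for K :: "'k ring" (structure) and g :: "('k, 'a) module" (structure)
begin

abbreviation lie_br (infixl "\<circ>\<^sub>L" 75) where "x \<circ>\<^sub>L y \<equiv> lie_bracket g x y"

lemma bracket_zero_right [simp]: "x \<in> carrier g \<Longrightarrow> x \<otimes>\<^bsub>g\<^esub> \<zero>\<^bsub>g\<^esub> = \<zero>\<^bsub>g\<^esub>"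
  using bracket_smult_right[of "\<zero>\<^bsub>K\<^esub>" x "\<zero>\<^bsub>g\<^esub>"] by (simp add: bracket_closed)

lemma bracket_zero_left [simp]: "x \<in> carrier g \<Longrightarrow> \<zero>\<^bsub>g\<^esub> \<otimes>\<^bsub>g\<^esub> x = \<zero>\<^bsub>g\<^esub>"
  using bracket_smult_left[of "\<zero>\<^bsub>K\<^esub>" "\<zero>\<^bsub>g\<^esub>" x] by (simp add: bracket_closed)

lemma lie_bracket_closed [simp]:
  "x \<in> carrier g \<Longrightarrow> y \<in> carrier g \<Longrightarrow> x \<circ>\<^sub>L y \<in> carrier g"
  by (simp add: lie_bracket_def bracket_closed)

lemma lie_bracket_commute: "x \<in> carrier g \<Longrightarrow> y \<in> carrier g \<Longrightarrow> x \<circ>\<^sub>L y = y \<circ>\<^sub>L x"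
  by (simp add: lie_bracket_def bracket_closed M.add.m_comm)

lemma lie_bracket_zero_right [simp]: "x \<in> carrier g \<Longrightarrow> x \<circ>\<^sub>L \<zero>\<^bsub>g\<^esub> = \<zero>\<^bsub>g\<^esub>"
  by (simp add: lie_bracket_def)

lemma lie_bracket_add_right:
  "x \<in> carrier g \<Longrightarrow> y \<in> carrier g \<Longrightarrow> z \<in> carrier g \<Longrightarrow>
   x \<circ>\<^sub>L (y \<oplus>\<^bsub>g\<^esub> z) = x \<circ>\<^sub>L y \<oplus>\<^bsub>g\<^esub> x \<circ>\<^sub>L z"
  by (simp add: lie_bracket_def bracket_closed bracket_add_left bracket_add_right M.add.m_ac)

lemma lie_bracket_smult_right:
  "k \<in> carrier K \<Longrightarrow> x \<in> carrier g \<Longrightarrow> y \<in> carrier g \<Longrightarrow>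
   x \<circ>\<^sub>L (k \<odot>\<^bsub>g\<^esub> y) = k \<odot>\<^bsub>g\<^esub> (x \<circ>\<^sub>L y)"
  by (simp add: lie_bracket_def bracket_closed bracket_smult_left bracket_smult_right smult_r_distr)

text \<open>The Leibniz identity expands \<open>[x,[y,z]]\<close> and \<open>[x,[z,y]]\<close> into
  the same two terms with opposite signs.\<close>

lemma bracket_lie_bracket [simp]:
  "x \<in> carrier g \<Longrightarrow> y \<in> carrier g \<Longrightarrow> z \<in> carrier g \<Longrightarrow> x \<otimes>\<^bsub>g\<^esub> (y \<circ>\<^sub>L z) = \<zero>\<^bsub>g\<^esub>"
  by (simp add: lie_bracket_def bracket_closed bracket_add_right leibniz_identity M.minus_eq
      M.add.m_ac M.r_neg2 M.r_neg)

lemma minus_eq_smult: "x \<in> carrier g \<Longrightarrow> \<ominus>\<^bsub>g\<^esub> x = (\<ominus>\<^bsub>K\<^esub> \<one>\<^bsub>K\<^esub>) \<odot>\<^bsub>g\<^esub> x"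
  by (simp add: smult_l_minus)

text \<open>Closure under negatives comes from scaling by minus one.\<close>

lemma submoduleI_smult:
  assumes "H \<subseteq> carrier g" "\<zero>\<^bsub>g\<^esub> \<in> H"
    and "\<And>a b. a \<in> H \<Longrightarrow> b \<in> H \<Longrightarrow> a \<oplus>\<^bsub>g\<^esub> b \<in> H"
    and "\<And>k a. k \<in> carrier K \<Longrightarrow> a \<in> H \<Longrightarrow> k \<odot>\<^bsub>g\<^esub> a \<in> H"
  shows "submodule H K g"
proof (rule submoduleI)
  show "\<ominus>\<^bsub>g\<^esub> a \<in> H" if "a \<in> H" for a
    using assms(1) assms(4)[of "\<ominus>\<^bsub>K\<^esub> \<one>\<^bsub>K\<^esub>" a] that minus_eq_smult[of a] by auto
qed (use assms in auto)

lemma submodule_zero: "submodule H K g \<Longrightarrow> \<zero>\<^bsub>g\<^esub> \<in> H"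
  using subgroup.one_closed[OF submodule.axioms(1)] by fastforce

lemma lie_center_iff: "z \<in> lie_center g \<longleftrightarrow> z \<in> carrier g \<and> (\<forall>x\<in>carrier g. x \<circ>\<^sub>L z = \<zero>\<^bsub>g\<^esub>)"
  by (simp add: lie_center_def)

lemma submodule_lie_center: "submodule (lie_center g) K g"
  by (rule submoduleI_smult)
    (auto simp: lie_center_iff lie_bracket_add_right lie_bracket_smult_right)

lemma ideal_generated_by_mem: "s \<in> S \<Longrightarrow> s \<in> ideal_generated_by K g S"
  by (auto simp: ideal_generated_by_def)

lemma ideal_generated_by_least:
  "two_sided_ideal K g I \<Longrightarrow> S \<subseteq> I \<Longrightarrow> ideal_generated_by K g S \<subseteq> I"
  by (auto simp: ideal_generated_by_def)

lemma two_sided_ideal_carrier: "two_sided_ideal K g (carrier g)"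
  by (simp add: two_sided_ideal_def carrier_is_submodule bracket_closed)

text \<open>Since \<open>S\<close> lies in the carrier, the carrier is one of the ideals being
  intersected. Otherwise the family would be empty and its intersection the whole type.\<close>

lemma submodule_ideal_generated_by:
  assumes "S \<subseteq> carrier g"
  shows "submodule (ideal_generated_by K g S) K g"
proof (rule submoduleI_smult)
  show "ideal_generated_by K g S \<subseteq> carrier g"
    using assms by (intro ideal_generated_by_least two_sided_ideal_carrier)
qed (auto simp: ideal_generated_by_def two_sided_ideal_def submodule_zero
    dest: submoduleE(4,5))

lemma linear_map_zero: "f \<in> linear_maps K g g \<Longrightarrow> f \<zero>\<^bsub>g\<^esub> = \<zero>\<^bsub>g\<^esub>"
proof -
  assume f: "f \<in> linear_maps K g g"
  then have "f \<zero>\<^bsub>g\<^esub> \<in> carrier g" by (auto simp: linear_maps_def)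
  moreover have "f (\<zero>\<^bsub>K\<^esub> \<odot>\<^bsub>g\<^esub> \<zero>\<^bsub>g\<^esub>) = \<zero>\<^bsub>K\<^esub> \<odot>\<^bsub>g\<^esub> f \<zero>\<^bsub>g\<^esub>"
    using f unfolding linear_maps_def by blast
  ultimately show ?thesis by simp
qed

lemma linear_map_closed: "f \<in> linear_maps K g g \<Longrightarrow> x \<in> carrier g \<Longrightarrow> f x \<in> carrier g"
  by (auto simp: linear_maps_def)

lemma linear_map_add:
  "f \<in> linear_maps K g g \<Longrightarrow> x \<in> carrier g \<Longrightarrow> y \<in> carrier g \<Longrightarrow> f (x \<oplus>\<^bsub>g\<^esub> y) = f x \<oplus>\<^bsub>g\<^esub> f y"
  by (simp add: linear_maps_def)

lemma linear_map_smult: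
  "f \<in> linear_maps K g g \<Longrightarrow> k \<in> carrier K \<Longrightarrow> x \<in> carrier g \<Longrightarrow> f (k \<odot>\<^bsub>g\<^esub> x) = k \<odot>\<^bsub>g\<^esub> f x"
  by (simp add: linear_maps_def)

end

section \<open>The commutator ideal and the Lie-center in class 2\<close>

locale lie_nilpotent_class_two = plain_leibniz_algebra K g
  for K :: "'k ring" (structure) and g :: "('k, 'a) module" (structure) +
  assumes class_two: "lie_nilpotent_of_class K g 2"
begin

abbreviation Z where "Z \<equiv> lie_center g"
abbreviation L where "L \<equiv> lie_commutator K g (carrier g) (carrier g)"

lemma lie_bracket_in_L: "x \<in> carrier g \<Longrightarrow> y \<in> carrier g \<Longrightarrow> x \<circ>\<^sub>L y \<in> L"
  unfolding lie_commutator_def by (rule ideal_generated_by_mem) blast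

lemma submodule_L: "submodule L K g"
  unfolding lie_commutator_def by (rule submodule_ideal_generated_by) auto

lemma L_carrier: "l \<in> L \<Longrightarrow> l \<in> carrier g"
  using submoduleE(1)[OF submodule_L] by blast

lemma Z_carrier: "z \<in> Z \<Longrightarrow> z \<in> carrier g"
  by (simp add: lie_center_iff)

text \<open>The third term of the series is \<open>lie_commutator K g L (carrier g)\<close>. It is
  zero in class 2, and every product of an element of \<open>L\<close> with an element of
  \<open>g\<close> is one of its generators.\<close>

lemma L_subset_Z: "L \<subseteq> Z"
proof
  fix l assume l: "l \<in> L"
  have "lie_commutator K g L (carrier g) = {\<zero>\<^bsub>g\<^esub>}"
    using class_two by (simp add: lie_nilpotent_of_class_def numeral_2_eq_2)
  moreover have "l \<circ>\<^sub>L x \<in> lie_commutator K g L (carrier g)" if "x \<in> carrier g" for x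
    unfolding lie_commutator_def[of K g L] by (rule ideal_generated_by_mem) (use l that in blast)
  ultimately show "l \<in> Z"
    using L_carrier[OF l] by (auto simp: lie_center_iff lie_bracket_commute)
qed

lemma L_nontrivial: "L \<noteq> {\<zero>\<^bsub>g\<^esub>}"
  using class_two by (simp add: lie_nilpotent_of_class_def numeral_2_eq_2)

text \<open>If everything were central, all generators of \<open>L\<close> would be zero and
  \<open>L\<close> would be the zero ideal. The element found here is where a functional vanishing
  on \<open>Z\<close> can take the value one.\<close>

lemma ex_not_central: "\<exists>v\<in>carrier g. v \<notin> Z"
proof (rule ccontr)
  assume "\<not> ?thesis"
  then have "x \<circ>\<^sub>L y = \<zero>\<^bsub>g\<^esub>" if "x \<in> carrier g" "y \<in> carrier g" for x y
    using that by (auto simp: lie_center_iff)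
  moreover have "two_sided_ideal K g {\<zero>\<^bsub>g\<^esub>}"
    unfolding two_sided_ideal_def by (auto intro: submoduleI_smult)
  ultimately have "L \<subseteq> {\<zero>\<^bsub>g\<^esub>}"
    unfolding lie_commutator_def by (intro ideal_generated_by_least) auto
  then show False using L_nontrivial submodule_zero[OF submodule_L] by blast
qed

text \<open>
  The generators of \<open>L\<close> are only known to span it as an ideal, so the vanishing of \<open>f\<close> is carried
  through an ideal on which the bracket with \<open>g\<close> vanishes as well.
\<close>

lemma vanishing_on_L:
  assumes "f \<in> linear_maps K g g"
    and "\<And>x y. x \<in> carrier g \<Longrightarrow> y \<in> carrier g \<Longrightarrow> f (x \<circ>\<^sub>L y) = \<zero>\<^bsub>g\<^esub>"
    and "l \<in> L"
  shows "f l = \<zero>\<^bsub>g\<^esub>" and "x \<in> carrier g \<Longrightarrow> x \<otimes>\<^bsub>g\<^esub> l = \<zero>\<^bsub>g\<^esub>"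
proof -
  let ?I = "{l \<in> Z. f l = \<zero>\<^bsub>g\<^esub> \<and> (\<forall>x\<in>carrier g. x \<otimes>\<^bsub>g\<^esub> l = \<zero>\<^bsub>g\<^esub>)}"
  note ZE = submoduleE(4,5)[OF submodule_lie_center] submodule_zero[OF submodule_lie_center]
  have "submodule ?I K g"
    by (rule submoduleI_smult)
      (auto simp: ZE Z_carrier linear_map_zero[OF assms(1)] linear_map_add[OF assms(1)]
        linear_map_smult[OF assms(1)] bracket_add_right bracket_smult_right)
  moreover have "a \<otimes>\<^bsub>g\<^esub> x \<in> ?I \<and> x \<otimes>\<^bsub>g\<^esub> a \<in> ?I" if "a \<in> ?I" "x \<in> carrier g" for a x
  proof -
    \<comment> \<open>For central \<open>a\<close> the bracket of \<open>a\<close> with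
      \<open>x\<close> is the negative of the bracket of \<open>x\<close> with \<open>a\<close>, so
      control of one side suffices.\<close>
    have "x \<circ>\<^sub>L a = \<zero>\<^bsub>g\<^esub>" "a \<in> carrier g" using that by (auto simp: lie_center_iff)
    then have "a \<otimes>\<^bsub>g\<^esub> x = \<zero>\<^bsub>g\<^esub>" using that by (simp add: lie_bracket_def bracket_closed)
    then show ?thesis using that by (auto simp: ZE linear_map_zero[OF assms(1)])
  qed
  ultimately have "two_sided_ideal K g ?I" unfolding two_sided_ideal_def by blast
  then have "L \<subseteq> ?I"
    unfolding lie_commutator_def
  proof (rule ideal_generated_by_least)
    \<comment> \<open>A generator is central by \<open>L_subset_Z\<close>, killed by
      \<open>f\<close> by assumption, and killed by brackets from the left by
      \<open>bracket_lie_bracket\<close>.\<close>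
    show "{x \<circ>\<^sub>L y |x y. x \<in> carrier g \<and> y \<in> carrier g} \<subseteq> ?I"
      using assms(2) lie_bracket_in_L L_subset_Z by auto
  qed
  then show "f l = \<zero>\<^bsub>g\<^esub>" "x \<in> carrier g \<Longrightarrow> x \<otimes>\<^bsub>g\<^esub> l = \<zero>\<^bsub>g\<^esub>"
    using assms(3) by auto
qed

text \<open>The zero map serves as \<open>f\<close> in \<open>vanishing_on_L\<close>. This will make
  the bracket on \<open>L\<close>, and so on the target algebra, trivial.\<close>

lemma bracket_L: "x \<in> carrier g \<Longrightarrow> l \<in> L \<Longrightarrow> x \<otimes>\<^bsub>g\<^esub> l = \<zero>\<^bsub>g\<^esub>"
  by (rule vanishing_on_L(2)[of "\<lambda>x\<in>carrier g. \<zero>\<^bsub>g\<^esub>"]) (auto simp: linear_maps_def)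

section \<open>Central Lie-derivations and their center\<close>

text \<open>When \<open>d\<close> takes values in \<open>Z\<close>, both terms on the right of the
  derivation rule are zero. The rule then says that \<open>d\<close> kills the generators of
  \<open>L\<close>, which is the same as killing \<open>L\<close> by
  \<open>vanishing_on_L\<close>.\<close>

lemma central_lie_derivation_iff:
  "d \<in> carrier (central_lie_der_algebra K g) \<longleftrightarrow>
   d \<in> linear_maps K g g \<and> d ` carrier g \<subseteq> Z \<and> (\<forall>l\<in>L. d l = \<zero>\<^bsub>g\<^esub>)" (is "?A \<longleftrightarrow> ?B")
proof
  assume A: ?A
  then have d: "d \<in> linear_maps K g g" "d ` carrier g \<subseteq> Z"
    and der: "\<And>x y. x \<in> carrier g \<Longrightarrow> y \<in> carrier g \<Longrightarrow>
      d (x \<circ>\<^sub>L y) = d x \<circ>\<^sub>L y \<oplus>\<^bsub>g\<^esub> x \<circ>\<^sub>L d y"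
    by (auto simp: central_lie_der_algebra_def lie_derivations_def)
  have dZ: "d x \<in> Z" if "x \<in> carrier g" for x using d(2) that by blast
  have "d (x \<circ>\<^sub>L y) = \<zero>\<^bsub>g\<^esub>" if "x \<in> carrier g" "y \<in> carrier g" for x y
    using der[OF that] dZ[OF that(1)] dZ[OF that(2)] that lie_bracket_commute[of "d x" y]
    by (simp add: lie_center_iff)
  then show ?B using d vanishing_on_L(1) by blast
next
  assume B: ?B
  then have dZ: "d x \<in> Z" if "x \<in> carrier g" for x using that by blast
  have "d (x \<circ>\<^sub>L y) = d x \<circ>\<^sub>L y \<oplus>\<^bsub>g\<^esub> x \<circ>\<^sub>L d y" if "x \<in> carrier g" "y \<in> carrier g" for x y
    using B dZ[OF that(1)] dZ[OF that(2)] that lie_bracket_commute[of "d x" y] lie_bracket_in_L[OF that]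
    by (simp add: lie_center_iff)
  then show ?A using B by (auto simp: central_lie_der_algebra_def lie_derivations_def)
qed

text \<open>These maps are the test elements from which the center is computed. They take values in
  the submodule \<open>Z\<close> and vanish on \<open>L\<close> along with \<open>\<phi>\<close>, as
  \<open>central_lie_derivation_iff\<close> requires.\<close>

lemma rank_one_central_lie_derivation:
  assumes "\<phi> \<in> carrier g \<rightarrow> carrier K"
    "\<And>x y. x \<in> carrier g \<Longrightarrow> y \<in> carrier g \<Longrightarrow> \<phi> (x \<oplus>\<^bsub>g\<^esub> y) = \<phi> x \<oplus>\<^bsub>K\<^esub> \<phi> y"
    "\<And>k x. k \<in> carrier K \<Longrightarrow> x \<in> carrier g \<Longrightarrow> \<phi> (k \<odot>\<^bsub>g\<^esub> x) = k \<otimes>\<^bsub>K\<^esub> \<phi> x"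
    "\<And>l. l \<in> L \<Longrightarrow> \<phi> l = \<zero>\<^bsub>K\<^esub>" and w: "w \<in> Z"
  shows "(\<lambda>x\<in>carrier g. \<phi> x \<odot>\<^bsub>g\<^esub> w) \<in> carrier (central_lie_der_algebra K g)"
proof -
  have \<phi>: "\<phi> x \<in> carrier K" if "x \<in> carrier g" for x using assms(1) that by blast
  have "w \<in> carrier g" using w by (rule Z_carrier)
  then have "(\<lambda>x\<in>carrier g. \<phi> x \<odot>\<^bsub>g\<^esub> w) \<in> linear_maps K g g"
    using \<phi> assms(2,3) by (auto simp: linear_maps_def smult_l_distr smult_assoc1)
  then show ?thesis
    using \<open>w \<in> carrier g\<close> \<phi> w assms(4) submoduleE(4)[OF submodule_lie_center]
    by (auto simp: central_lie_derivation_iff L_carrier)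
qed

lemma center_iff:
  "d \<in> carrier (center_algebra (central_lie_der_algebra K g)) \<longleftrightarrow>
   d \<in> linear_maps K g g \<and> d ` carrier g \<subseteq> L \<and> (\<forall>z\<in>Z. d z = \<zero>\<^bsub>g\<^esub>)" (is "?A \<longleftrightarrow> ?B")
proof
  assume ?A
  then have D: "d \<in> carrier (central_lie_der_algebra K g)"
    and comm: "\<And>e. e \<in> carrier (central_lie_der_algebra K g) \<Longrightarrow>
      (\<lambda>x\<in>carrier g. d (e x) \<ominus>\<^bsub>g\<^esub> e (d x)) = (\<lambda>x\<in>carrier g. \<zero>\<^bsub>g\<^esub>)"
    by (auto simp: center_algebra_def central_lie_der_algebra_def lie_der_algebra_def
        linear_map_algebra_def)
  have d: "d \<in> linear_maps K g g" and dZ: "\<And>x. x \<in> carrier g \<Longrightarrow> d x \<in> Z"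
    using D by (auto simp: central_lie_derivation_iff)
  note dc = linear_map_closed[OF d]
  \<comment> \<open>The commutator of \<open>d\<close> with the rank one map given by
    \<open>\<phi>\<close> and \<open>w\<close>, evaluated at \<open>x\<close>.\<close>
  have rank_one: "\<phi> x \<odot>\<^bsub>g\<^esub> d w = \<phi> (d x) \<odot>\<^bsub>g\<^esub> w"
    if "\<phi> \<in> carrier g \<rightarrow> carrier K"
    "\<And>x y. x \<in> carrier g \<Longrightarrow> y \<in> carrier g \<Longrightarrow> \<phi> (x \<oplus>\<^bsub>g\<^esub> y) = \<phi> x \<oplus>\<^bsub>K\<^esub> \<phi> y"
    "\<And>k x. k \<in> carrier K \<Longrightarrow> x \<in> carrier g \<Longrightarrow> \<phi> (k \<odot>\<^bsub>g\<^esub> x) = k \<otimes>\<^bsub>K\<^esub> \<phi> x"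
    "\<And>l. l \<in> L \<Longrightarrow> \<phi> l = \<zero>\<^bsub>K\<^esub>" "w \<in> Z" "x \<in> carrier g" for \<phi> w x
  proof -
    have w: "w \<in> carrier g" and \<phi>: "\<phi> x \<in> carrier K" "\<phi> (d x) \<in> carrier K"
      using that(1,5,6) dc Z_carrier by auto
    have "d (\<phi> x \<odot>\<^bsub>g\<^esub> w) \<ominus>\<^bsub>g\<^esub> \<phi> (d x) \<odot>\<^bsub>g\<^esub> w = \<zero>\<^bsub>g\<^esub>"
      using fun_cong[OF comm[OF rank_one_central_lie_derivation[OF that(1-5)]], of x] that(6) dc
      by simp
    then have "\<phi> x \<odot>\<^bsub>g\<^esub> d w \<oplus>\<^bsub>g\<^esub> \<ominus>\<^bsub>g\<^esub> (\<phi> (d x) \<odot>\<^bsub>g\<^esub> w) = \<zero>\<^bsub>g\<^esub>"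
      using linear_map_smult[OF d \<phi>(1) w] by (simp add: M.minus_eq)
    then show ?thesis
      using M.minus_equality w \<phi> dc[OF w]
      by (metis M.a_inv_closed M.minus_minus smult_closed)
  qed
  have kills: "d w = \<zero>\<^bsub>g\<^esub>" if w: "w \<in> Z" for w
  proof -
    \<comment> \<open>The choice \<open>x = v\<close> with \<open>\<phi> v\<close> equal to one
      isolates \<open>d w\<close>; the other side is zero because \<open>d v\<close> is central and
      \<open>\<phi>\<close> vanishes on \<open>Z\<close>.\<close>
    obtain v where v: "v \<in> carrier g" "v \<notin> Z" using ex_not_central by blast
    obtain \<phi> where \<phi>: "\<phi> \<in> carrier g \<rightarrow> carrier K"
      "\<And>x y. x \<in> carrier g \<Longrightarrow> y \<in> carrier g \<Longrightarrow> \<phi> (x \<oplus>\<^bsub>g\<^esub> y) = \<phi> x \<oplus>\<^bsub>K\<^esub> \<phi> y"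
      "\<And>k x. k \<in> carrier K \<Longrightarrow> x \<in> carrier g \<Longrightarrow> \<phi> (k \<odot>\<^bsub>g\<^esub> x) = k \<otimes>\<^bsub>K\<^esub> \<phi> x"
      "\<And>z. z \<in> Z \<Longrightarrow> \<phi> z = \<zero>\<^bsub>K\<^esub>" "\<phi> v = \<one>\<^bsub>K\<^esub>"
      using separating_functional[OF K.field_axioms submodule_lie_center v] by blast
    have "\<phi> l = \<zero>\<^bsub>K\<^esub>" if "l \<in> L" for l using \<phi>(4) L_subset_Z that by blast
    then have "\<phi> v \<odot>\<^bsub>g\<^esub> d w = \<phi> (d v) \<odot>\<^bsub>g\<^esub> w"
      using rank_one[OF \<phi>(1-3) _ w v(1)] by blast
    then show ?thesis using \<phi>(4)[OF dZ[OF v(1)]] \<phi>(5) w dc[of w] by (simp add: Z_carrier)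
  qed
  have "d x \<in> L" if x: "x \<in> carrier g" for x
  proof (rule ccontr)
    assume "d x \<notin> L"
    then obtain \<phi> where \<phi>: "\<phi> \<in> carrier g \<rightarrow> carrier K"
      "\<And>x y. x \<in> carrier g \<Longrightarrow> y \<in> carrier g \<Longrightarrow> \<phi> (x \<oplus>\<^bsub>g\<^esub> y) = \<phi> x \<oplus>\<^bsub>K\<^esub> \<phi> y"
      "\<And>k x. k \<in> carrier K \<Longrightarrow> x \<in> carrier g \<Longrightarrow> \<phi> (k \<odot>\<^bsub>g\<^esub> x) = k \<otimes>\<^bsub>K\<^esub> \<phi> x"
      "\<And>z. z \<in> L \<Longrightarrow> \<phi> z = \<zero>\<^bsub>K\<^esub>" "\<phi> (d x) = \<one>\<^bsub>K\<^esub>"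
      using separating_functional[OF K.field_axioms submodule_L dc[OF x]] by blast
    \<comment> \<open>Any nonzero central \<open>w\<close> would do here, and \<open>L\<close>
      supplies one. As \<open>d w\<close> is zero, the relation at \<open>x\<close> reduces to
      \<open>w\<close> being zero.\<close>
    obtain w where w: "w \<in> L" "w \<noteq> \<zero>\<^bsub>g\<^esub>"
      using L_nontrivial submodule_zero[OF submodule_L] by blast
    then have "w \<in> Z" using L_subset_Z by blast
    have "\<phi> x \<odot>\<^bsub>g\<^esub> d w = \<phi> (d x) \<odot>\<^bsub>g\<^esub> w"
      using rank_one[OF \<phi>(1-4) \<open>w \<in> Z\<close> x] by blast
    moreover have "\<phi> x \<in> carrier K" using \<phi>(1) x by blast
    ultimately show False
      using kills[OF \<open>w \<in> Z\<close>] \<phi>(5) w L_carrier by simp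
  qed
  then show ?B using d kills by blast
next
  assume B: ?B
  then have d: "d \<in> linear_maps K g g" and dL: "\<And>x. x \<in> carrier g \<Longrightarrow> d x \<in> L"
    and dz: "\<And>z. z \<in> Z \<Longrightarrow> d z = \<zero>\<^bsub>g\<^esub>" by auto
  have "d \<in> carrier (central_lie_der_algebra K g)"
    using B L_subset_Z by (auto simp: central_lie_derivation_iff)
  moreover have "(\<lambda>x\<in>carrier g. d (e x) \<ominus>\<^bsub>g\<^esub> e (d x)) = (\<lambda>x\<in>carrier g. \<zero>\<^bsub>g\<^esub>)"
    if "e \<in> carrier (central_lie_der_algebra K g)" for e
  proof (rule restrict_ext)
    fix x assume x: "x \<in> carrier g"
    \<comment> \<open>Both terms of the commutator vanish separately: \<open>d\<close> kills the
      central element \<open>e x\<close>, and \<open>e\<close> kills \<open>d x\<close>, which lies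
      in \<open>L\<close>.\<close>
    then have "e x \<in> Z" "e (d x) = \<zero>\<^bsub>g\<^esub>"
      using that dL by (auto simp: central_lie_derivation_iff)
    then show "d (e x) \<ominus>\<^bsub>g\<^esub> e (d x) = \<zero>\<^bsub>g\<^esub>" by (simp add: dz M.minus_eq M.r_neg)
  qed
  ultimately show ?A
    by (auto simp: center_algebra_def central_lie_der_algebra_def lie_der_algebra_def
        linear_map_algebra_def)
qed

section \<open>The quotient by the Lie-center\<close>

abbreviation C where "C \<equiv> center_algebra (central_lie_der_algebra K g)"
abbreviation Q where "Q \<equiv> quotient_algebra g Z"
abbreviation T where "T \<equiv> linear_map_algebra K Q (g\<lparr>carrier := L\<rparr>)"
abbreviation coset where "coset x \<equiv> Z +>\<^bsub>g\<^esub> x"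

lemma abelian_subgroup_Z: "abelian_subgroup Z g"
  by (intro abelian_subgroupI3 additive_subgroupI submodule.axioms(1)[OF submodule_lie_center]
      M.abelian_group_axioms)

lemma coset_mem_iff: "y \<in> coset x \<longleftrightarrow> (\<exists>z\<in>Z. y = z \<oplus>\<^bsub>g\<^esub> x)"
  by (auto simp: a_r_coset_def')

lemma coset_eq: "y \<in> coset x \<Longrightarrow> x \<in> carrier g \<Longrightarrow> coset y = coset x"
  using abelian_subgroup.a_repr_independence'[OF abelian_subgroup_Z] by blast

lemma coset_self: "x \<in> carrier g \<Longrightarrow> x \<in> coset x"
  using abelian_subgroup.a_rcos_self[OF abelian_subgroup_Z] by blast

lemma carrier_Q: "carrier Q = coset ` carrier g"
  by (auto simp: quotient_algebra_def A_RCOSETS_def')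

lemma coset_add: "x \<in> carrier g \<Longrightarrow> y \<in> carrier g \<Longrightarrow> coset x \<oplus>\<^bsub>Q\<^esub> coset y = coset (x \<oplus>\<^bsub>g\<^esub> y)"
  using abelian_subgroup.a_rcos_sum[OF abelian_subgroup_Z] by (simp add: quotient_algebra_def)

text \<open>The product in \<open>Q\<close> is a union of cosets over all representatives. They
  coincide because \<open>Z\<close> is closed under scaling, and the union is not empty because
  \<open>x\<close> is itself a representative.\<close>

lemma coset_smult:
  assumes k: "k \<in> carrier K" and x: "x \<in> carrier g"
  shows "k \<odot>\<^bsub>Q\<^esub> coset x = coset (k \<odot>\<^bsub>g\<^esub> x)"
proof -
  have *: "coset (k \<odot>\<^bsub>g\<^esub> y) = coset (k \<odot>\<^bsub>g\<^esub> x)" if "y \<in> coset x" for y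
  proof (rule coset_eq)
    obtain z where z: "z \<in> Z" "y = z \<oplus>\<^bsub>g\<^esub> x" using \<open>y \<in> coset x\<close> by (auto simp: coset_mem_iff)
    then have "k \<odot>\<^bsub>g\<^esub> y = k \<odot>\<^bsub>g\<^esub> z \<oplus>\<^bsub>g\<^esub> k \<odot>\<^bsub>g\<^esub> x"
      using k x by (simp add: smult_r_distr Z_carrier)
    moreover have "k \<odot>\<^bsub>g\<^esub> z \<in> Z" using submoduleE(4)[OF submodule_lie_center k] z(1) by blast
    ultimately show "k \<odot>\<^bsub>g\<^esub> y \<in> coset (k \<odot>\<^bsub>g\<^esub> x)" by (auto simp: coset_mem_iff)
  qed (use k x in simp)
  have "k \<odot>\<^bsub>Q\<^esub> coset x = (\<Union>y\<in>coset x. coset (k \<odot>\<^bsub>g\<^esub> y))"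
    by (simp add: quotient_algebra_def)
  also have "\<dots> = coset (k \<odot>\<^bsub>g\<^esub> x)"
    by (rule SUP_eq_const) (use coset_self[OF x] in blast, rule *)
  finally show ?thesis .
qed

lemma carrier_C_D:
  assumes "d \<in> carrier C"
  shows "d \<in> linear_maps K g g" "\<And>x. x \<in> carrier g \<Longrightarrow> d x \<in> L" "\<And>z. z \<in> Z \<Longrightarrow> d z = \<zero>\<^bsub>g\<^esub>"
  using assms by (auto simp: center_iff)

section \<open>Linear maps induced on the quotient\<close>

text \<open>The value is taken at a chosen representative; independence of the choice is available
  only for \<open>d\<close> vanishing on \<open>Z\<close>, through \<open>induced_coset\<close>.
  Restriction to \<open>carrier Q\<close> makes the result extensional, as
  \<open>linear_maps\<close> demands.\<close>

definition induced :: "('a \<Rightarrow> 'a) \<Rightarrow> 'a set \<Rightarrow> 'a" where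
  "induced d = (\<lambda>X\<in>carrier Q. d (SOME x. x \<in> X))"

text \<open>Two representatives differ by an element of \<open>Z\<close>, which \<open>d\<close>
  kills.\<close>

lemma induced_coset:
  assumes d: "d \<in> carrier C" and x: "x \<in> carrier g"
  shows "induced d (coset x) = d x"
proof -
  have "d y = d x" if "y \<in> coset x" for y
  proof -
    obtain z where "z \<in> Z" "y = z \<oplus>\<^bsub>g\<^esub> x"
      using \<open>y \<in> coset x\<close> by (auto simp: coset_mem_iff)
    then show ?thesis
      using carrier_C_D[OF d] x linear_map_closed[of d x] by (simp add: linear_map_add Z_carrier)
  qed
  moreover have "(SOME y. y \<in> coset x) \<in> coset x" using coset_self[OF x] by (rule someI)
  ultimately show ?thesis using x by (simp add: induced_def carrier_Q)
qed

text \<open>Linearity on the quotient is rewritten through representatives, so that later arguments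
  use only the operations of \<open>g\<close>.\<close>

lemma linear_maps_Q_iff:
  "f \<in> carrier T \<longleftrightarrow> f \<in> extensional (carrier Q) \<and> (\<forall>x\<in>carrier g. f (coset x) \<in> L) \<and>
   (\<forall>x\<in>carrier g. \<forall>y\<in>carrier g. f (coset (x \<oplus>\<^bsub>g\<^esub> y)) = f (coset x) \<oplus>\<^bsub>g\<^esub> f (coset y)) \<and>
   (\<forall>k\<in>carrier K. \<forall>x\<in>carrier g. f (coset (k \<odot>\<^bsub>g\<^esub> x)) = k \<odot>\<^bsub>g\<^esub> f (coset x))"
  by (auto simp: linear_map_algebra_def linear_maps_def carrier_Q PiE_iff coset_add coset_smult)

lemma induced_in_T: "d \<in> carrier C \<Longrightarrow> induced d \<in> carrier T"
  using carrier_C_D[of d]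
  by (simp add: linear_maps_Q_iff induced_coset linear_map_add linear_map_smult)
    (simp add: induced_def)

lemma add_in_C:
  assumes "d \<in> carrier C" "e \<in> carrier C"
  shows "(\<lambda>x\<in>carrier g. d x \<oplus>\<^bsub>g\<^esub> e x) \<in> carrier C"
  using carrier_C_D[OF assms(1)] carrier_C_D[OF assms(2)] submoduleE(5)[OF submodule_L]
  by (auto simp: center_iff linear_maps_def Z_carrier L_carrier smult_r_distr M.add.m_ac)

lemma smult_in_C:
  assumes "k \<in> carrier K" "d \<in> carrier C"
  shows "(\<lambda>x\<in>carrier g. k \<odot>\<^bsub>g\<^esub> d x) \<in> carrier C"
proof -
  \<comment> \<open>A scalar multiple of a linear map is linear because \<open>K\<close> is
    commutative.\<close>
  have "k \<odot>\<^bsub>g\<^esub> (j \<odot>\<^bsub>g\<^esub> d x) = j \<odot>\<^bsub>g\<^esub> (k \<odot>\<^bsub>g\<^esub> d x)" if "j \<in> carrier K" "x \<in> carrier g" for j x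
    using assms that carrier_C_D[OF assms(2)]
    by (simp add: smult_assoc1[symmetric] L_carrier K.m_comm)
  then show ?thesis
    using assms(1) carrier_C_D[OF assms(2)] submoduleE(4)[OF submodule_L]
    by (auto simp: center_iff linear_maps_def Z_carrier L_carrier smult_r_distr)
qed

lemma extensional_Q_eqI:
  assumes "f \<in> extensional (carrier Q)" "h \<in> extensional (carrier Q)"
    "\<And>x. x \<in> carrier g \<Longrightarrow> f (coset x) = h (coset x)"
  shows "f = h"
  by (rule extensionalityI[OF assms(1,2)]) (use assms(3) in \<open>auto simp: carrier_Q\<close>)

lemma induced_extensional: "induced d \<in> extensional (carrier Q)"
  by (simp add: induced_def)

text \<open>Injectivity holds because \<open>induced d\<close> determines \<open>d\<close> through
  its values on cosets. For surjectivity, a map on the quotient is composed with the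
  projection.\<close>

lemma bij_induced: "bij_betw induced (carrier C) (carrier T)"
proof (rule bij_betw_imageI)
  show "inj_on induced (carrier C)"
  proof (rule inj_onI)
    fix d e assume de: "d \<in> carrier C" "e \<in> carrier C" "induced d = induced e"
    have "d \<in> extensional (carrier g)" "e \<in> extensional (carrier g)"
      using de by (auto simp: center_iff linear_maps_def PiE_iff)
    moreover have "d x = e x" if "x \<in> carrier g" for x
      using induced_coset[OF de(1) that] induced_coset[OF de(2) that] de(3) by simp
    ultimately show "d = e" by (rule extensionalityI)
  qed
  have "f \<in> induced ` carrier C" if f: "f \<in> carrier T" for f
  proof
    let ?d = "\<lambda>x\<in>carrier g. f (coset x)"
    note fD = f[unfolded linear_maps_Q_iff]
    have "?d \<in> linear_maps K g g"
      using fD L_carrier by (auto simp: linear_maps_def)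
    moreover have "?d z = \<zero>\<^bsub>g\<^esub>" if "z \<in> Z" for z
    proof -
      \<comment> \<open>A central element has the same coset as zero, so the pulled back map gives
        both the same value.\<close>
      have "z \<in> coset \<zero>\<^bsub>g\<^esub>" using that by (auto simp: coset_mem_iff Z_carrier)
      then have "?d z = ?d \<zero>\<^bsub>g\<^esub>" using coset_eq that by (simp add: Z_carrier)
      then show ?thesis using linear_map_zero[OF \<open>?d \<in> linear_maps K g g\<close>] by simp
    qed
    ultimately show d: "?d \<in> carrier C" using fD by (auto simp: center_iff)
    show "f = induced ?d"
      by (rule extensional_Q_eqI)
        (use fD induced_coset[OF d] induced_extensional in \<open>simp_all\<close>)
  qed
  then show "induced ` carrier C = carrier T" using induced_in_T by blast
qed

section \<open>The isomorphism of algebras\<close>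

lemma center_central_lie_derivations_isomorphic: "algebra_isomorphic K C T"
proof -
  \<comment> \<open>An element of \<open>linear_maps\<close> must be \<open>undefined\<close>
    outside its domain, hence the restriction.\<close>
  let ?\<Phi> = "restrict induced (carrier C)"
  have C_ops: "add C = (\<lambda>d e. \<lambda>x\<in>carrier g. d x \<oplus>\<^bsub>g\<^esub> e x)"
    "smult C = (\<lambda>k d. \<lambda>x\<in>carrier g. k \<odot>\<^bsub>g\<^esub> d x)" "zero C = (\<lambda>x\<in>carrier g. \<zero>\<^bsub>g\<^esub>)"
    by (simp_all add: center_algebra_def central_lie_der_algebra_def lie_der_algebra_def
        linear_map_algebra_def)
  have T_ops: "add T = (\<lambda>f h. \<lambda>X\<in>carrier Q. f X \<oplus>\<^bsub>g\<^esub> h X)"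
    "smult T = (\<lambda>k f. \<lambda>X\<in>carrier Q. k \<odot>\<^bsub>g\<^esub> f X)"
    "mult T = (\<lambda>f h. \<lambda>X\<in>carrier Q. f X \<otimes>\<^bsub>g\<^esub> h X)"
    by (simp_all add: linear_map_algebra_def)
  have zero_C: "(\<lambda>x\<in>carrier g. \<zero>\<^bsub>g\<^esub>) \<in> carrier C"
    by (auto simp: center_iff linear_maps_def submodule_zero[OF submodule_L] Z_carrier)
  have mult_C: "d \<otimes>\<^bsub>C\<^esub> e = (\<lambda>x\<in>carrier g. \<zero>\<^bsub>g\<^esub>)" if "d \<in> carrier C" "e \<in> carrier C" for d e
    using that C_ops(3) by (auto simp: center_algebra_def)
  have "?\<Phi> \<in> linear_maps K C T"
    unfolding linear_maps_def
  proof (intro CollectI conjI ballI)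
    show "?\<Phi> \<in> carrier C \<rightarrow>\<^sub>E carrier T" using induced_in_T by auto
  next
    fix d e assume de: "d \<in> carrier C" "e \<in> carrier C"
    have "induced (d \<oplus>\<^bsub>C\<^esub> e) = induced d \<oplus>\<^bsub>T\<^esub> induced e"
      by (rule extensional_Q_eqI)
        (use de in \<open>auto simp: induced_extensional[unfolded carrier_Q] C_ops T_ops induced_coset add_in_C carrier_Q\<close>)
    then show "?\<Phi> (d \<oplus>\<^bsub>C\<^esub> e) = ?\<Phi> d \<oplus>\<^bsub>T\<^esub> ?\<Phi> e"
      using de add_in_C[OF de] by (simp add: C_ops)
  next
    fix k d assume kd: "k \<in> carrier K" "d \<in> carrier C"
    have "induced (k \<odot>\<^bsub>C\<^esub> d) = k \<odot>\<^bsub>T\<^esub> induced d"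
      by (rule extensional_Q_eqI)
        (use kd in \<open>auto simp: induced_extensional[unfolded carrier_Q] C_ops T_ops induced_coset smult_in_C carrier_Q\<close>)
    then show "?\<Phi> (k \<odot>\<^bsub>C\<^esub> d) = k \<odot>\<^bsub>T\<^esub> ?\<Phi> d"
      using kd smult_in_C[OF kd] by (simp add: C_ops)
  qed
  moreover have "bij_betw ?\<Phi> (carrier C) (carrier T)"
    using bij_induced by (simp cong: bij_betw_cong)
  moreover have "?\<Phi> (d \<otimes>\<^bsub>C\<^esub> e) = ?\<Phi> d \<otimes>\<^bsub>T\<^esub> ?\<Phi> e" if de: "d \<in> carrier C" "e \<in> carrier C" for d e
  proof -
    \<comment> \<open>Both brackets are zero: in the center by definition, and in the target by
      \<open>bracket_L\<close>, since \<open>e x\<close> lies in \<open>L\<close>.\<close>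
    have "induced (\<lambda>x\<in>carrier g. \<zero>\<^bsub>g\<^esub>) = induced d \<otimes>\<^bsub>T\<^esub> induced e"
    proof (rule extensional_Q_eqI)
      fix x assume x: "x \<in> carrier g"
      have "d x \<otimes>\<^bsub>g\<^esub> e x = \<zero>\<^bsub>g\<^esub>"
        using x de carrier_C_D(2) L_carrier by (blast intro: bracket_L)
      then show "induced (\<lambda>x\<in>carrier g. \<zero>\<^bsub>g\<^esub>) (coset x) = (induced d \<otimes>\<^bsub>T\<^esub> induced e) (coset x)"
        using x de by (simp add: induced_coset zero_C T_ops carrier_Q)
    qed (simp_all add: induced_extensional T_ops)
    then show ?thesis using de zero_C by (simp add: mult_C)
  qed
  ultimately show ?thesis unfolding algebra_isomorphic_def by blast
qed

end

theorem theorem3p10: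
  fixes K :: "'k ring" and q :: "('k, 'a) module"
  assumes "leibniz_algebra K q"
    and "\<one>\<^bsub>K\<^esub> \<oplus>\<^bsub>K\<^esub> \<one>\<^bsub>K\<^esub> \<in> Units K"
    and "lie_nilpotent_of_class K q 2"
  shows "algebra_isomorphic K
    (center_algebra (central_lie_der_algebra K q))
    (linear_map_algebra K
       (quotient_algebra q (lie_center q))
       (q\<lparr>carrier := lie_commutator K q (carrier q) (carrier q)\<rparr>))"
proof -
  interpret lie_nilpotent_class_two K q
    using assms(1,3)
    by (simp add: lie_nilpotent_class_two_def plain_leibniz_algebra_def
        lie_nilpotent_class_two_axioms_def)
  show ?thesis by (rule center_central_lie_derivations_isomorphic)
qed

end
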